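(* Let $(X,p)$ be a partial metric space and $r\ge 0$. Every $r$-convergent sequence in $(X,p)$ is bounded.
   Context: A partial metric on a nonempty set $X$ is a function $p:X\times X\to[0,\infty)$ such that for all $x,y,z\in X$: (p1) $0\le p(x,x)\le p(x,y)$; (p2) $x=y \iff p(x,x)=p(x,y)=p(y,y)$; (p3) $p(x,y)=p(y,x)$; (p4) $p(x,y)\le p(x,z)+p(z,y)-p(z,z)$. The pair $(X,p)$ is a partial metric space. For a real number $r\ge 0$, a sequence $\{x_n\}$ in $X$ is $r$-convergent to $x\in X$ if for every $\epsilon>0$ there is $k\in\mathbb{N}$ such that $|p(x_n,x)-p(x,x)|<r+\epsilon$ for all $n\ge k$. It is $r$-convergent if it is $r$-convergent to some $x\in X$. A sequence $\{x_n\}$ in $X$ is bounded if there is a real $M>0$ such that $\sup\{p(x_n,x_m):n,m\in\mathbb{N}\}<M$. *)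

theory Defs
  imports Complex_Main "HOL-Library.Extended_Real"
begin

text \<open>
  The values of \<^term>\<open>p\<close> outside the carrier are unconstrained. On the carrier,
  \<open>self_nonneg\<close> and \<open>self_le\<close> together also express that \<^term>\<open>p\<close> takes
  values in \<open>[0, \<infinity>)\<close>.
\<close>

locale partial_metric_space =
  fixes X :: "'a set" and p :: "'a \<Rightarrow> 'a \<Rightarrow> real"
  assumes nonempty: "X \<noteq> {}"
    and self_nonneg: "x \<in> X \<Longrightarrow> 0 \<le> p x x"
    and self_le: "\<lbrakk>x \<in> X; y \<in> X\<rbrakk> \<Longrightarrow> p x x \<le> p x y"
    and eq_iff: "\<lbrakk>x \<in> X; y \<in> X\<rbrakk> \<Longrightarrow> x = y \<longleftrightarrow> p x x = p x y \<and> p x y = p y y"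
    and commute: "\<lbrakk>x \<in> X; y \<in> X\<rbrakk> \<Longrightarrow> p x y = p y x"
    and triangle: "\<lbrakk>x \<in> X; y \<in> X; z \<in> X\<rbrakk> \<Longrightarrow> p x y \<le> p x z + p z y - p z z"

definition r_convergent_to ::
    "('a \<Rightarrow> 'a \<Rightarrow> real) \<Rightarrow> real \<Rightarrow> (nat \<Rightarrow> 'a) \<Rightarrow> 'a \<Rightarrow> bool" where
  "r_convergent_to p r s x \<longleftrightarrow> (\<forall>\<epsilon>>0. \<exists>k. \<forall>n\<ge>k. \<bar>p (s n) x - p x x\<bar> < r + \<epsilon>)"

definition r_convergent ::
    "'a set \<Rightarrow> ('a \<Rightarrow> 'a \<Rightarrow> real) \<Rightarrow> real \<Rightarrow> (nat \<Rightarrow> 'a) \<Rightarrow> bool" where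
  "r_convergent X p r s \<longleftrightarrow> (\<exists>x\<in>X. r_convergent_to p r s x)"

text \<open>
  The supremum is taken in the extended reals, because the supremum operator on
  \<^typ>\<open>real\<close> is unspecified on sets that are not bounded above.
\<close>

definition p_bounded_seq :: "('a \<Rightarrow> 'a \<Rightarrow> real) \<Rightarrow> (nat \<Rightarrow> 'a) \<Rightarrow> bool" where
  "p_bounded_seq p s \<longleftrightarrow>
     (\<exists>M::real. M > 0 \<and> Sup {ereal (p (s n) (s m)) | n m. True} < ereal M)"

end

theory Submission
  imports Defs
begin

text \<open>Any two terms are compared through an \<open>r\<close>-limit \<open>x\<close>. By
  \<open>r_convergent_to_imp_Bseq\<close> the values \<open>p (s n) x\<close> are bounded by some
  \<open>B\<close>: a tail stays close to \<open>p x x\<close>, and the finitely many earlier terms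
  cannot spoil boundedness. The triangle inequality through \<open>x\<close> then bounds all mutual
  distances by \<open>2 * B\<close>.\<close>

lemma r_convergent_to_imp_Bseq:
  assumes "r_convergent_to p r s x"
  shows "Bseq (\<lambda>n. p (s n) x)"
proof -
  obtain k where k: "\<And>n. n \<ge> k \<Longrightarrow> \<bar>p (s n) x - p x x\<bar> < r + 1"
    using assms unfolding r_convergent_to_def by (meson zero_less_one)
  have "norm (p (s n) x) \<le> \<bar>p x x\<bar> + r + 1" if "n \<ge> k" for n
    using k[OF that] by simp
  then show ?thesis
    \<comment> \<open>\<open>Bseq\<close> only asks for an eventual bound, so the tail from
      \<open>k\<close> on suffices here.\<close>
    by (intro BfunI) (auto simp: eventually_sequentially)
qed

theorem theorem3p8:
  fixes X :: "'a set" and p :: "'a \<Rightarrow> 'a \<Rightarrow> real"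
    and r :: real and s :: "nat \<Rightarrow> 'a"
  assumes "partial_metric_space X p"
    and "r \<ge> 0"
    and "\<And>n. s n \<in> X"
    and "r_convergent X p r s"
  shows "p_bounded_seq p s"
proof -
  interpret partial_metric_space X p by fact
  obtain x where x: "x \<in> X" "r_convergent_to p r s x"
    using assms(4) unfolding r_convergent_def by blast
  \<comment> \<open>\<open>BseqE\<close> turns the eventual bound into one for all \<open>n\<close>,
    absorbing the initial terms.\<close>
  obtain B where B: "B > 0" "\<And>n. norm (p (s n) x) \<le> B"
    using r_convergent_to_imp_Bseq[OF x(2)] by (auto elim: BseqE)
  have "p (s n) (s m) \<le> 2 * B" for n m
    using triangle[OF assms(3)[of n] assms(3)[of m] x(1)] commute[OF x(1) assms(3)[of m]]
      self_nonneg[OF x(1)] B(2)[of n] B(2)[of m]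
    by simp
  then have "Sup {ereal (p (s n) (s m)) | n m. True} \<le> ereal (2 * B)"
    by (intro Sup_least) auto
  \<comment> \<open>The extra 1 supplies the strict inequality demanded of the supremum.\<close>
  also have "\<dots> < ereal (2 * B + 1)"
    by simp
  finally show ?thesis
    unfolding p_bounded_seq_def using B(1) by (intro exI[of _ "2 * B + 1"]) simp
qed

end
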